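(* Let $\{b_n\}$ be a sequence of positive integers together with a decomposition rule under which every positive integer $z$ has a unique decomposition $z = b_{\ell_1} + \cdots + b_{\ell_{k(z)}}$ with $\ell_1 \le \ell_2 \le \cdots \le \ell_{k(z)}$. Fix constants $c_1,d_1,c_2,d_2$ such that $I_n := [b_{c_1 n + d_1}, b_{c_2 n + d_2})$ (an interval of integers) is well defined for all $n>0$. For $z \in I_n$ let $$\nu_{z,n}(x) := \frac{1}{k(z)-1}\sum_{j=2}^{k(z)} \delta\big(x - (\ell_j - \ell_{j-1})\big)$$ be its spacing gap measure. Let $N_{\rm gaps}(n) := \sum_{z \in I_n}(k(z)-1)$, let $$\nu_n(x) := \frac{1}{N_{\rm gaps}(n)}\sum_{z\in I_n}\sum_{j=2}^{k(z)}\delta\big(x-(\ell_j-\ell_{j-1})\big) = \sum_{g=0}^{c_2n+d_2-1} P_n(g)\,\delta(x-g)$$ be the average spacing gap measure, where $P_n(g)$ is the proportion of gaps of length $g$ among all gaps in the decompositions of all $z \in I_n$. For $g_1,g_2\ge 0$ let $X_{j_1,j_1+g_1,j_2,j_2+g_2}(n)$ be the number of $z \in I_n$ whose decomposition contains $b_{j_1}, b_{j_1+g_1}, b_{j_2}, b_{j_2+g_2}$ but does not contain $b_{j_1+q}$ for $0<q<g_1$ nor $b_{j_2+p}$ for $0<p<g_2$. Assume: (1) For $z$ chosen uniformly from $I_n$, the number of summands $k(z)$ converges to a Gaussian with mean $\mu_n = c_{\rm mean} n + O(1)$ and variance $\sigma_n^2 = c_{\rm var} n + O(1)$ for constants $c_{\rm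 mean}, c_{\rm var} > 0$, and $k(z) \ll n$ for all $z \in I_n$; (2) the limits $\nu(x) := \lim_{n\to\infty}\nu_n(x)$ and $P(g) := \lim_{n\to\infty} P_n(g)$ exist for every $g$; (3) for all $g_1,g_2\ge 0$, $$\frac{2}{|I_n|\mu_n^2}\sum_{j_1<j_2} X_{j_1,j_1+g_1,j_2,j_2+g_2}(n) = P(g_1)P(g_2) + \mathrm{error}(n,g_1,g_2),$$ where $\lim_{n\to\infty}\sum_{g_1,g_2}\mathrm{error}(n,g_1,g_2) = 0$. Then, for $z \in I_n$, the individual gap measures $\nu_{z,n}$ converge almost surely in distribution to the average gap measure $\nu$ (i.e., as $n\to\infty$, for almost all $z\in I_n$ the measures $\nu_{z,n}$ converge in distribution to $\nu$).
   Context: $\delta(x-a)$ denotes the Dirac delta (unit point mass at $a$). $|I_n|$ is the number of integers in $I_n$. $k(z)$ is the number of summands in the decomposition of $z$.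
   Formalization: In (3) the condition is that the sum over g_1,g_2 of |error(n,g_1,g_2)| tends to 0; with the signed sum the claim is false (b_{2m}=b_{2m+1}=2^m, even z using only even indices, odd z alternating even and odd indices). *)

theory Defs
  imports "HOL-Probability.Probability"
begin

text \<open>
  A decomposition is a nondecreasing list of indices \<open>\<ell>\<^sub>1 \<le> \<dots> \<le> \<ell>\<^sub>k\<close> (repetitions allowed) and
  stands for \<open>b \<ell>\<^sub>1 + \<dots> + b \<ell>\<^sub>k\<close>. A decomposition rule is an arbitrary predicate \<open>legal\<close> on such
  lists. Indices are natural numbers; a sequence indexed from 1 is covered by a rule that never
  uses the index 0.
\<close>

definition decomposition_of :: "(nat \<Rightarrow> nat) \<Rightarrow> (nat list \<Rightarrow> bool) \<Rightarrow> nat \<Rightarrow> nat list \<Rightarrow> bool" where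
  "decomposition_of b legal z l \<longleftrightarrow> legal l \<and> sorted l \<and> sum_list (map b l) = z"

definition unique_decompositions :: "(nat \<Rightarrow> nat) \<Rightarrow> (nat list \<Rightarrow> bool) \<Rightarrow> bool" where
  "unique_decompositions b legal \<longleftrightarrow> (\<forall>z>0. \<exists>!l. decomposition_of b legal z l)"

definition decomp :: "(nat \<Rightarrow> nat) \<Rightarrow> (nat list \<Rightarrow> bool) \<Rightarrow> nat \<Rightarrow> nat list" where
  "decomp b legal z = (THE l. decomposition_of b legal z l)"

lemma decomp_eq_iff:
  assumes "unique_decompositions b legal" "z > 0"
  shows "decomp b legal z = l \<longleftrightarrow> decomposition_of b legal z l"
  using assms theI'[of "decomposition_of b legal z"]
  unfolding unique_decompositions_def decomp_def by blast

definition int_interval :: "(nat \<Rightarrow> nat) \<Rightarrow> int \<Rightarrow> int \<Rightarrow> int \<Rightarrow> int \<Rightarrow> nat \<Rightarrow> nat set" where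
  "int_interval b c1 d1 c2 d2 n = {b (nat (c1 * int n + d1))..<b (nat (c2 * int n + d2))}"

text \<open>Lists are indexed from 0, so the gaps of a list of length \<open>k\<close> are \<open>gap l j\<close> for
  \<open>1 \<le> j < k\<close>. On sorted lists the natural-number subtraction does not truncate.\<close>

definition gap :: "nat list \<Rightarrow> nat \<Rightarrow> nat" where
  "gap l j = l ! j - l ! (j - 1)"

text \<open>The Borel measure \<open>1/N \<cdot> \<Sum>i\<in>S. \<delta>(x - f i)\<close>; the null measure if \<open>S\<close> is empty.\<close>

definition dirac_average :: "nat \<Rightarrow> 'i set \<Rightarrow> ('i \<Rightarrow> real) \<Rightarrow> real measure" where
  "dirac_average N S f =
     measure_of UNIV (sets borel) (\<lambda>A. (\<Sum>i\<in>S. emeasure (return borel (f i)) A) / of_nat N)"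

lemma space_dirac_average [simp]: "space (dirac_average N S f) = UNIV"
  by (simp add: dirac_average_def space_measure_of_conv)

lemma sets_dirac_average [simp, measurable_cong]: "sets (dirac_average N S f) = sets borel"
  unfolding dirac_average_def by (metis sets.sets_measure_of_eq space_borel)

lemma emeasure_dirac_average:
  assumes "A \<in> sets borel"
  shows "emeasure (dirac_average N S f) A = (\<Sum>i\<in>S. emeasure (return borel (f i)) A) / of_nat N"
proof (rule emeasure_measure_of[OF dirac_average_def])
  show "countably_additive (sets (dirac_average N S f))
          (\<lambda>A. (\<Sum>i\<in>S. emeasure (return borel (f i)) A) / of_nat N)"
  proof (rule countably_additiveI)
    fix F :: "nat \<Rightarrow> real set"
    assume F: "range F \<subseteq> sets (dirac_average N S f)" "disjoint_family F"
    have "(\<Sum>n. (\<Sum>i\<in>S. emeasure (return borel (f i)) (F n)) / of_nat N)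
        = (\<Sum>i\<in>S. \<Sum>n. emeasure (return borel (f i)) (F n)) / of_nat N"
      by (simp add: divide_ennreal_def ennreal_suminf_multc suminf_sum)
    also have "\<dots> = (\<Sum>i\<in>S. emeasure (return borel (f i)) (\<Union>n. F n)) / of_nat N"
      using F by (intro arg_cong2[where f = "(/)"] sum.cong refl suminf_emeasure) auto
    finally show "(\<Sum>n. (\<Sum>i\<in>S. emeasure (return borel (f i)) (F n)) / of_nat N)
        = (\<Sum>i\<in>S. emeasure (return borel (f i)) (\<Union>n. F n)) / of_nat N" .
  qed
qed (use assms in \<open>auto simp: positive_def\<close>)

definition individual_gap_measure :: "nat list \<Rightarrow> real measure" where
  "individual_gap_measure l =
     dirac_average (length l - 1) {1..<length l} (\<lambda>j. real (gap l j))"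

text \<open>Below, \<open>dec\<close> maps a number to its decomposition and \<open>Z\<close> is a finite set of numbers.\<close>

definition num_gaps :: "(nat \<Rightarrow> nat list) \<Rightarrow> nat set \<Rightarrow> nat" where
  "num_gaps dec Z = (\<Sum>z\<in>Z. length (dec z) - 1)"

definition average_gap_measure :: "(nat \<Rightarrow> nat list) \<Rightarrow> nat set \<Rightarrow> real measure" where
  "average_gap_measure dec Z =
     dirac_average (num_gaps dec Z) (SIGMA z:Z. {1..<length (dec z)})
       (\<lambda>(z, j). real (gap (dec z) j))"

definition gap_proportion :: "(nat \<Rightarrow> nat list) \<Rightarrow> nat set \<Rightarrow> nat \<Rightarrow> real" where
  "gap_proportion dec Z g =
     real (card {(z, j). z \<in> Z \<and> 1 \<le> j \<and> j < length (dec z) \<and> gap (dec z) j = g})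
       / real (num_gaps dec Z)"

text \<open>The decomposition \<open>l\<close> contains \<open>b j\<close> and \<open>b (j + g)\<close> as two summands with no summand of
  intermediate index. Containment is that of multisets: for \<open>g = 0\<close> the index \<open>j\<close> has to occur at
  least twice in \<open>l\<close>, since a gap of length 0 is a repeated summand.\<close>

definition has_gap_at :: "nat list \<Rightarrow> nat \<Rightarrow> nat \<Rightarrow> bool" where
  "has_gap_at l j g \<longleftrightarrow>
     {#j, j + g#} \<subseteq># mset l \<and> (\<forall>q. 0 < q \<and> q < g \<longrightarrow> j + q \<notin> set l)"

definition two_gap_count ::
    "(nat \<Rightarrow> nat list) \<Rightarrow> nat set \<Rightarrow> nat \<Rightarrow> nat \<Rightarrow> nat \<Rightarrow> nat \<Rightarrow> nat" where
  "two_gap_count dec Z j1 g1 j2 g2 =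
     card {z\<in>Z. has_gap_at (dec z) j1 g1 \<and> has_gap_at (dec z) j2 g2}"

end

theory Submission
  imports Defs
begin

text \<open>
  For a decomposition \<open>l\<close> let \<open>N g\<close> be the number of gaps of length \<open>g\<close>, let \<open>S g\<close> be the number of
  indices \<open>j\<close> with \<open>has_gap_at l j g\<close>, and let \<open>K = length l - 1\<close>. Then \<open>S g \<le> N g\<close> and
  \<open>\<Sum>g. N g = K\<close>. With means taken over \<open>I n\<close>, the two-gap condition at \<open>g\<^sub>1 = g\<^sub>2 = g\<close> says that
  the mean of \<open>(S g)\<^sup>2 / \<mu>\<^sup>2\<close> tends to \<open>(P g)\<^sup>2\<close>, while the mean of \<open>N g / \<mu>\<close> tends to \<open>P g\<close>. The
  only possible discrepancy between \<open>S\<close> and \<open>N\<close>, due to summands repeated more than twice, is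
  negligible: \<open>(N g - S g)\<^sup>2 + (\<Sum>h<G. S h)\<^sup>2 \<le> K\<^sup>2\<close> for \<open>g < G\<close>, where the mean of \<open>K\<^sup>2 / \<mu>\<^sup>2\<close>
  tends to 1 and that of the second square over \<open>\<mu>\<^sup>2\<close> is asymptotically at least \<open>(\<Sum>h<G. P h)\<^sup>2\<close>,
  which is close to 1 because \<open>\<nu>\<close> is a probability measure. Hence \<open>N g / \<mu>\<close> converges to \<open>P g\<close> and
  \<open>K / \<mu>\<close> to 1 in mean square, so \<open>N g / K\<close> converges to \<open>P g\<close> for all \<open>g\<close> simultaneously on sets of
  asymptotically full proportion. As the measures live on the natural numbers, this is convergence
  of distribution functions.
\<close>

section \<open>Means over finite sets\<close>

text \<open>Division by zero makes the mean over an empty or infinite set \<open>0\<close>, so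
  linearity and monotonicity need no side conditions; only \<open>mean_on_const\<close>
  does.\<close>

definition mean_on :: "'a set \<Rightarrow> ('a \<Rightarrow> real) \<Rightarrow> real" where
  "mean_on Z f = (\<Sum>z\<in>Z. f z) / real (card Z)"

lemma mean_on_add: "mean_on Z (\<lambda>z. f z + g z) = mean_on Z f + mean_on Z g"
  by (simp add: mean_on_def sum.distrib add_divide_distrib)

lemma mean_on_diff: "mean_on Z (\<lambda>z. f z - g z) = mean_on Z f - mean_on Z g"
  by (simp add: mean_on_def sum_subtractf diff_divide_distrib)

lemma mean_on_cmult: "mean_on Z (\<lambda>z. c * f z) = c * mean_on Z f"
  by (simp add: mean_on_def sum_distrib_left)

lemma mean_on_divide: "mean_on Z (\<lambda>z. f z / c) = mean_on Z f / c"
  by (simp add: mean_on_def sum_divide_distrib [symmetric])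

lemma mean_on_const: "finite Z \<Longrightarrow> Z \<noteq> {} \<Longrightarrow> mean_on Z (\<lambda>_. c) = c"
  by (simp add: mean_on_def)

lemma mean_on_mono: "(\<And>z. z \<in> Z \<Longrightarrow> f z \<le> g z) \<Longrightarrow> mean_on Z f \<le> mean_on Z g"
  by (simp add: mean_on_def sum_mono divide_right_mono)

lemma mean_on_nonneg: "(\<And>z. z \<in> Z \<Longrightarrow> 0 \<le> f z) \<Longrightarrow> 0 \<le> mean_on Z f"
  by (simp add: mean_on_def sum_nonneg)

lemma mean_on_sum: "mean_on Z (\<lambda>z. \<Sum>i\<in>A. f i z) = (\<Sum>i\<in>A. mean_on Z (f i))"
proof -
  have "(\<Sum>z\<in>Z. \<Sum>i\<in>A. f i z) = (\<Sum>i\<in>A. \<Sum>z\<in>Z. f i z)"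
    by (rule sum.swap)
  then show ?thesis
    by (simp add: mean_on_def sum_divide_distrib [symmetric])
qed

lemma mean_on_power2_le: "(mean_on Z f)\<^sup>2 \<le> mean_on Z (\<lambda>z. (f z)\<^sup>2)"
proof (cases "card Z = 0")
  case False
  then show ?thesis
    using sum_squared_le_sum_of_squares [of f Z]
    by (simp add: mean_on_def power_divide field_simps power2_eq_square)
qed (simp add: mean_on_def)

lemma mean_on_markov:
  assumes "finite Z" and nonneg: "\<And>z. z \<in> Z \<Longrightarrow> 0 \<le> f z"
  shows "t * real (card {z\<in>Z. t < f z}) / real (card Z) \<le> mean_on Z f"
proof -
  have "t * real (card {z\<in>Z. t < f z}) = (\<Sum>z\<in>{z\<in>Z. t < f z}. t)"
    by simp
  also have "\<dots> \<le> (\<Sum>z\<in>{z\<in>Z. t < f z}. f z)"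
    by (intro sum_mono) auto
  also have "\<dots> \<le> (\<Sum>z\<in>Z. f z)"
    using assms by (intro sum_mono2) auto
  finally show ?thesis
    by (simp add: mean_on_def divide_right_mono)
qed

text \<open>Convergence in mean of countably many sequences yields common large sets of pointwise
  convergence: apply Markov's inequality to \<open>W = \<Sum>i. 2\<^sup>-\<^sup>i min 1 (Y i)\<close>.\<close>

lemma mean_tendsto_0_imp_typical:
  fixes Y :: "nat \<Rightarrow> nat \<Rightarrow> 'a \<Rightarrow> real"
  assumes Z: "\<And>n. n > 0 \<Longrightarrow> finite (Z n) \<and> Z n \<noteq> {}"
    and Y_nonneg: "\<And>i n z. 0 \<le> Y i n z"
    and Y_lim: "\<And>i. (\<lambda>n. mean_on (Z n) (Y i n)) \<longlonglongrightarrow> 0"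
  shows "\<exists>A. (\<forall>n. A n \<subseteq> Z n) \<and> (\<lambda>n. real (card (A n)) / real (card (Z n))) \<longlonglongrightarrow> 1 \<and>
             (\<forall>\<zeta>. (\<forall>\<^sub>F n in sequentially. \<zeta> n \<in> A n) \<longrightarrow> (\<forall>i. (\<lambda>n. Y i n (\<zeta> n)) \<longlonglongrightarrow> 0))"
proof -
  define V where "V = (\<lambda>i n z. (1 / 2) ^ i * min 1 (Y i n z))"
  define W where "W = (\<lambda>n z. \<Sum>i. V i n z)"
  have V_bounds: "0 \<le> V i n z" "V i n z \<le> (1 / 2) ^ i" for i n z
    using Y_nonneg by (auto simp: V_def mult_left_le)
  have geo: "summable (\<lambda>i. (1 / 2 :: real) ^ i)"
    by (simp add: summable_geometric)
  have V_summable: "summable (\<lambda>i. V i n z)" for n z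
    using V_bounds by (intro summable_comparison_test' [OF geo]) auto
  have V_le_W: "V i n z \<le> W n z" for i n z
    unfolding W_def using sum_le_suminf [OF V_summable, of "{i}"] V_bounds by simp
  have W_nonneg: "0 \<le> W n z" for n z
    unfolding W_def by (intro suminf_nonneg V_summable V_bounds)
  define w where "w = (\<lambda>n. mean_on (Z n) (W n))"
  have w_nonneg: "0 \<le> w n" for n
    unfolding w_def by (intro mean_on_nonneg W_nonneg)
  have w_eq: "w n = (\<Sum>i. mean_on (Z n) (V i n))" for n
    unfolding w_def mean_on_def W_def
    by (simp add: V_summable suminf_sum suminf_divide summable_sum)
  \<comment> \<open>Truncation at 1 makes this bound uniform in \<open>n\<close>, as Tannery's
    theorem requires for exchanging the limit with the sum over \<open>i\<close>. The case
    \<open>n = 0\<close> is included, where \<open>Z 0\<close> may be empty or infinite and the mean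
    is then \<open>0\<close>.\<close>
  have mean_V: "norm (mean_on (Z n) (V i n)) \<le> (1 / 2) ^ i" for i n
  proof -
    have "mean_on (Z n) (V i n) \<le> (1 / 2) ^ i"
    proof (cases "finite (Z n) \<and> Z n \<noteq> {}")
      case True
      then show ?thesis
        using mean_on_mono [of "Z n" "V i n" "\<lambda>_. (1 / 2) ^ i"] V_bounds
        by (simp add: mean_on_const)
    next
      case False
      then show ?thesis by (auto simp: mean_on_def)
    qed
    then show ?thesis
      using mean_on_nonneg [of "Z n" "V i n"] V_bounds by simp
  qed
  have mean_V_lim: "(\<lambda>n. mean_on (Z n) (V i n)) \<longlonglongrightarrow> 0" for i
  proof (rule tendsto_sandwich [OF _ _ tendsto_const])
    show "\<forall>\<^sub>F n in sequentially. mean_on (Z n) (V i n) \<le> (1 / 2) ^ i * mean_on (Z n) (Y i n)"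
      unfolding mean_on_cmult [symmetric]
      by (intro always_eventually allI mean_on_mono) (auto simp: V_def intro!: mult_left_mono)
    show "(\<lambda>n. (1 / 2) ^ i * mean_on (Z n) (Y i n)) \<longlonglongrightarrow> 0"
      using tendsto_mult_left [OF Y_lim] by simp
  qed (auto intro!: always_eventually mean_on_nonneg V_bounds)
  have w_lim: "w \<longlonglongrightarrow> 0"
    using tannerys_theorem [OF mean_V_lim always_eventually geo] mean_V
    by (simp add: w_eq [abs_def])
  have sqrt_w_lim: "(\<lambda>n. sqrt (w n)) \<longlonglongrightarrow> 0"
    using tendsto_real_sqrt [OF w_lim] by simp
  \<comment> \<open>The threshold \<open>sqrt (w n)\<close> serves two purposes: it tends to 0, so
    \<open>W n\<close> is small on \<open>A n\<close>, and Markov's inequality bounds the proportion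
    of exceptions by \<open>w n / sqrt (w n) = sqrt (w n)\<close>.\<close>
  define A where "A = (\<lambda>n. {z\<in>Z n. W n z \<le> sqrt (w n)})"
  have A_large: "1 - sqrt (w n) \<le> real (card (A n)) / real (card (Z n))"
    and A_small: "real (card (A n)) / real (card (Z n)) \<le> 1" if "n > 0" for n
  proof -
    define B where "B = {z\<in>Z n. sqrt (w n) < W n z}"
    have fin: "finite (Z n)" and ne: "card (Z n) > 0"
      using Z [OF that] by (auto simp: card_gt_0_iff)
    have "A n \<union> B = Z n" "A n \<inter> B = {}"
      by (auto simp: A_def B_def)
    then have card: "card (A n) + card B = card (Z n)"
      using fin card_Un_disjoint [of "A n" B] by (metis finite_Un)
    have B: "real (card B) / real (card (Z n)) \<le> sqrt (w n)"
    \<comment> \<open>At threshold 0 Markov's inequality is void, but then \<open>W n\<close>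
      vanishes on \<open>Z n\<close> and the strict inequality makes \<open>B\<close> empty.\<close>
    proof (cases "w n = 0")
      case True
      then have W_0: "W n z = 0" if "z \<in> Z n" for z
        using that fin ne W_nonneg
        by (auto simp: w_def mean_on_def sum_nonneg_eq_0_iff)
      have "\<not> sqrt (w n) < W n z" if "z \<in> Z n" for z
        using W_0 [OF that] True by simp
      then have "B = {}"
        unfolding B_def by blast
      then show ?thesis
        by (simp add: w_nonneg)
    next
      case False
      have "sqrt (w n) * (real (card B) / real (card (Z n))) \<le> sqrt (w n) * sqrt (w n)"
        using mean_on_markov [OF fin, of "W n" "sqrt (w n)"] W_nonneg w_nonneg
        by (simp add: w_def B_def)
      then show ?thesis
        using False w_nonneg [of n] unfolding mult_le_cancel_left by simp
    qed
    have "real (card (A n)) / real (card (Z n)) + real (card B) / real (card (Z n)) = 1"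
      using ne card by (simp add: add_divide_distrib [symmetric] flip: of_nat_add)
    with B show "1 - sqrt (w n) \<le> real (card (A n)) / real (card (Z n))" by linarith
    show "real (card (A n)) / real (card (Z n)) \<le> 1"
      using card ne by simp
  qed
  have "(\<lambda>n. real (card (A n)) / real (card (Z n))) \<longlonglongrightarrow> 1"
  proof (rule tendsto_sandwich)
    show "(\<lambda>n. 1 - sqrt (w n)) \<longlonglongrightarrow> 1"
      using tendsto_diff [OF tendsto_const sqrt_w_lim] by simp
    show "\<forall>\<^sub>F n in sequentially. 1 - sqrt (w n) \<le> real (card (A n)) / real (card (Z n))"
      using eventually_gt_at_top [of 0] by eventually_elim (rule A_large)
    show "\<forall>\<^sub>F n in sequentially. real (card (A n)) / real (card (Z n)) \<le> 1"
      using eventually_gt_at_top [of 0] by eventually_elim (rule A_small)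
  qed simp
  moreover have "(\<lambda>n. Y i n (\<zeta> n)) \<longlonglongrightarrow> 0" if \<zeta>: "\<forall>\<^sub>F n in sequentially. \<zeta> n \<in> A n" for \<zeta> i
  proof -
    have min_lim: "(\<lambda>n. min 1 (Y i n (\<zeta> n))) \<longlonglongrightarrow> 0"
    proof (rule tendsto_sandwich [OF _ _ tendsto_const])
      show "\<forall>\<^sub>F n in sequentially. min 1 (Y i n (\<zeta> n)) \<le> 2 ^ i * sqrt (w n)"
        using \<zeta>
      proof eventually_elim
        case (elim n)
        then have "V i n (\<zeta> n) \<le> sqrt (w n)"
          using V_le_W [of i n "\<zeta> n"] by (auto simp: A_def)
        then show ?case
          by (simp add: V_def power_one_over field_simps)
      qed
      show "(\<lambda>n. 2 ^ i * sqrt (w n)) \<longlonglongrightarrow> 0"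
        using tendsto_mult_left [OF sqrt_w_lim] by simp
    qed (auto simp: Y_nonneg)
    \<comment> \<open>A truncated value below 1 is the value itself, so the truncation is eventually
      harmless.\<close>
    then have "\<forall>\<^sub>F n in sequentially. min 1 (Y i n (\<zeta> n)) < 1"
      by (rule order_tendstoD) simp
    then have "\<forall>\<^sub>F n in sequentially. min 1 (Y i n (\<zeta> n)) = Y i n (\<zeta> n)"
      by eventually_elim (auto simp: min_def split: if_splits)
    then show ?thesis
      using min_lim by (rule Lim_transform_eventually [rotated])
  qed
  ultimately show ?thesis
    by (intro exI [of _ A]) (auto simp: A_def)
qed

lemma tendsto_power2_0_iff: "(\<lambda>n. (f n :: real)\<^sup>2) \<longlonglongrightarrow> 0 \<longleftrightarrow> f \<longlonglongrightarrow> 0"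
  using tendsto_real_sqrt [of "\<lambda>n. (f n)\<^sup>2" 0 sequentially] tendsto_power [of f 0 sequentially 2]
  by (auto simp: tendsto_rabs_zero_iff)

text \<open>\<open>T g h n\<close> is only a one-sided (\<open>j\<^sub>1 < j\<^sub>2\<close>) count, so it bounds the mean of \<open>s g n z * s h n z\<close>
  from below only after symmetrization.\<close>

lemma gap_fluctuation_tendsto_0:
  fixes x s :: "nat \<Rightarrow> nat \<Rightarrow> 'a \<Rightarrow> real" and \<kappa> :: "nat \<Rightarrow> 'a \<Rightarrow> real"
  assumes Z: "\<And>n. n > 0 \<Longrightarrow> finite (Z n) \<and> Z n \<noteq> {}"
    and s: "\<And>g n z. n > 0 \<Longrightarrow> z \<in> Z n \<Longrightarrow> 0 \<le> s g n z \<and> s g n z \<le> x g n z"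
    and x_sum: "\<And>G n z. n > 0 \<Longrightarrow> z \<in> Z n \<Longrightarrow> (\<Sum>g<G. x g n z) \<le> \<kappa> n z"
    and \<kappa>: "(\<lambda>n. mean_on (Z n) (\<lambda>z. (\<kappa> n z)\<^sup>2)) \<longlonglongrightarrow> 1"
    and x_mean: "\<And>g. (\<lambda>n. mean_on (Z n) (x g n)) \<longlonglongrightarrow> P g"
    and s_square: "\<And>g. (\<lambda>n. mean_on (Z n) (\<lambda>z. (s g n z)\<^sup>2)) \<longlonglongrightarrow> (P g)\<^sup>2"
    and T_lim: "\<And>g h. T g h \<longlonglongrightarrow> P g * P h"
    and T_le: "\<And>g h n. n > 0 \<Longrightarrow>
      T g h n + T h g n \<le> 2 * mean_on (Z n) (\<lambda>z. s g n z * s h n z)"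
    and P: "P sums 1"
  shows "(\<lambda>n. mean_on (Z n) (\<lambda>z. (x g n z - P g)\<^sup>2)) \<longlonglongrightarrow> 0"
proof -
  define D where "D = (\<lambda>n. mean_on (Z n) (\<lambda>z. (x g n z - s g n z)\<^sup>2))"
  have D_nonneg: "0 \<le> D n" for n
    unfolding D_def by (intro mean_on_nonneg) simp
  \<comment> \<open>The excess \<open>x - s\<close> at \<open>g\<close> and the sum of all
    \<open>s h\<close> with \<open>h < G\<close> are nonnegative and add up to at most
    \<open>\<kappa>\<close>, so their squares add up to at most its square. Exchanging
    \<open>h\<close> and \<open>h'\<close> does not change the double sum of \<open>T\<close>, so
    \<open>T_le\<close> bounds it by the mean of the second square.\<close>
  have D_le: "D n \<le> mean_on (Z n) (\<lambda>z. (\<kappa> n z)\<^sup>2) - (\<Sum>h<G. \<Sum>h'<G. T h h' n)"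
    if n: "n > 0" and G: "g < G" for n G
  proof -
    have swap: "(\<Sum>h<G. \<Sum>h'<G. T h' h n) = (\<Sum>h<G. \<Sum>h'<G. T h h' n)"
      by (rule sum.swap)
    have "2 * (\<Sum>h<G. \<Sum>h'<G. T h h' n) = (\<Sum>h<G. \<Sum>h'<G. T h h' n + T h' h n)"
      by (simp add: sum.distrib swap)
    also have "\<dots> \<le> (\<Sum>h<G. \<Sum>h'<G. 2 * mean_on (Z n) (\<lambda>z. s h n z * s h' n z))"
      by (intro sum_mono T_le n)
    also have "\<dots> = 2 * mean_on (Z n) (\<lambda>z. (\<Sum>h<G. s h n z)\<^sup>2)"
      by (simp only: power2_eq_square sum_product mean_on_sum) (simp only: sum_distrib_left)
    finally have T: "(\<Sum>h<G. \<Sum>h'<G. T h h' n) \<le> mean_on (Z n) (\<lambda>z. (\<Sum>h<G. s h n z)\<^sup>2)"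
      by simp
    have "mean_on (Z n) (\<lambda>z. (x g n z - s g n z)\<^sup>2 + (\<Sum>h<G. s h n z)\<^sup>2)
        \<le> mean_on (Z n) (\<lambda>z. (\<kappa> n z)\<^sup>2)"
    proof (rule mean_on_mono)
      fix z assume z: "z \<in> Z n"
      let ?d = "x g n z - s g n z" and ?S = "\<Sum>h<G. s h n z"
      have d: "0 \<le> ?d" and S: "0 \<le> ?S"
        using s [OF n z] by (auto intro!: sum_nonneg)
      have "?d \<le> (\<Sum>h<G. x h n z - s h n z)"
        using G s [OF n z] by (intro member_le_sum) auto
      then have "?d + ?S \<le> \<kappa> n z"
        using x_sum [OF n z, of G] by (simp add: sum_subtractf)
      then have "(?d + ?S)\<^sup>2 \<le> (\<kappa> n z)\<^sup>2"
        using d S by (intro power_mono) auto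
      moreover have "?d\<^sup>2 + ?S\<^sup>2 \<le> (?d + ?S)\<^sup>2"
        using mult_nonneg_nonneg [OF d S] unfolding power2_sum by (simp only: mult.assoc)
      ultimately show "?d\<^sup>2 + ?S\<^sup>2 \<le> (\<kappa> n z)\<^sup>2" by linarith
    qed
    then show ?thesis
      using T by (simp add: mean_on_add D_def)
  qed
  have D_lim: "D \<longlonglongrightarrow> 0"
  proof (rule order_tendstoI)
    fix a :: real assume "0 < a"
    \<comment> \<open>The cutoff \<open>G\<close> is fixed first, in terms of \<open>a\<close>; for
      this \<open>G\<close> only finitely many \<open>T h h'\<close> have to pass to the limit in
      \<open>n\<close>.\<close>
    have "(\<lambda>G. 1 - (\<Sum>h<G. P h)\<^sup>2) \<longlonglongrightarrow> 1 - 1\<^sup>2"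
      using P unfolding sums_def by (intro tendsto_intros)
    then have "\<forall>\<^sub>F G in sequentially. 1 - (\<Sum>h<G. P h)\<^sup>2 < a"
      by (rule order_tendstoD) (use \<open>0 < a\<close> in simp)
    then have "\<forall>\<^sub>F G in sequentially. 1 - (\<Sum>h<G. P h)\<^sup>2 < a \<and> g < G"
      using eventually_gt_at_top [of g] by eventually_elim simp
    then obtain G where G: "1 - (\<Sum>h<G. P h)\<^sup>2 < a" "g < G"
      using eventually_happens trivial_limit_sequentially by blast
    have "(\<lambda>n. mean_on (Z n) (\<lambda>z. (\<kappa> n z)\<^sup>2) - (\<Sum>h<G. \<Sum>h'<G. T h h' n))
        \<longlonglongrightarrow> 1 - (\<Sum>h<G. \<Sum>h'<G. P h * P h')"
      by (intro tendsto_intros \<kappa> T_lim)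
    then have "\<forall>\<^sub>F n in sequentially.
        mean_on (Z n) (\<lambda>z. (\<kappa> n z)\<^sup>2) - (\<Sum>h<G. \<Sum>h'<G. T h h' n) < a"
      by (rule order_tendstoD) (use G in \<open>simp add: power2_eq_square sum_product\<close>)
    then show "\<forall>\<^sub>F n in sequentially. D n < a"
      using eventually_gt_at_top [of 0]
    proof eventually_elim
      case (elim n)
      then show ?case
        using D_le [of n G] G(2) by linarith
    qed
  next
    fix a :: real assume "a < 0"
    then show "\<forall>\<^sub>F n in sequentially. a < D n"
      by (intro always_eventually allI less_le_trans [OF _ D_nonneg])
  qed
  have "(\<lambda>n. (mean_on (Z n) (x g n) - mean_on (Z n) (s g n))\<^sup>2) \<longlonglongrightarrow> 0"
    by (rule tendsto_sandwich [OF _ _ tendsto_const D_lim])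
      (auto simp: D_def mean_on_power2_le simp flip: mean_on_diff)
  then have diff: "(\<lambda>n. mean_on (Z n) (x g n) - mean_on (Z n) (s g n)) \<longlonglongrightarrow> 0"
    by (simp add: tendsto_power2_0_iff)
  have s_mean: "(\<lambda>n. mean_on (Z n) (s g n)) \<longlonglongrightarrow> P g"
    using tendsto_diff [OF x_mean [of g] diff] by simp
  \<comment> \<open>The bound is the mean of
    \<open>2 * (s - P g)\<^sup>2 + 2 * (x - s)\<^sup>2\<close>, which dominates
    \<open>(x - P g)\<^sup>2\<close>. Its first part vanishes in the limit because the second moment
    of \<open>s\<close> tends to the square of the limit of its mean.\<close>
  have upper: "(\<lambda>n. 2 * (mean_on (Z n) (\<lambda>z. (s g n z)\<^sup>2) - 2 * P g * mean_on (Z n) (s g n)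
      + (P g)\<^sup>2) + 2 * D n) \<longlonglongrightarrow> 2 * ((P g)\<^sup>2 - 2 * P g * P g + (P g)\<^sup>2) + 2 * 0"
    by (intro tendsto_intros s_square s_mean D_lim)
  show ?thesis
  proof (rule tendsto_sandwich [OF _ _ tendsto_const])
    show "\<forall>\<^sub>F n in sequentially. mean_on (Z n) (\<lambda>z. (x g n z - P g)\<^sup>2)
      \<le> 2 * (mean_on (Z n) (\<lambda>z. (s g n z)\<^sup>2) - 2 * P g * mean_on (Z n) (s g n)
        + (P g)\<^sup>2) + 2 * D n"
      using eventually_gt_at_top [of 0]
    proof eventually_elim
      case (elim n)
      have "mean_on (Z n) (\<lambda>z. (x g n z - P g)\<^sup>2)
          \<le> mean_on (Z n) (\<lambda>z. 2 * ((s g n z)\<^sup>2 - 2 * P g * s g n z + (P g)\<^sup>2)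
                + 2 * (x g n z - s g n z)\<^sup>2)"
      proof (rule mean_on_mono)
        fix z
        have "0 \<le> ((s g n z - P g) - (x g n z - s g n z))\<^sup>2" by simp
        then show "(x g n z - P g)\<^sup>2 \<le> 2 * ((s g n z)\<^sup>2 - 2 * P g * s g n z + (P g)\<^sup>2)
                + 2 * (x g n z - s g n z)\<^sup>2"
          by (simp add: power2_eq_square algebra_simps)
      qed
      then show ?case
        using Z [OF elim]
        by (simp add: mean_on_add mean_on_diff mean_on_cmult mean_on_const D_def)
    qed
    show "(\<lambda>n. 2 * (mean_on (Z n) (\<lambda>z. (s g n z)\<^sup>2) - 2 * P g * mean_on (Z n) (s g n)
      + (P g)\<^sup>2) + 2 * D n) \<longlonglongrightarrow> 0"
      using upper by (simp add: power2_eq_square)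
  qed (auto intro!: always_eventually mean_on_nonneg)
qed


section \<open>Counting gaps\<close>

definition gap_count :: "nat list \<Rightarrow> nat \<Rightarrow> nat" where
  "gap_count l g = card {j. 1 \<le> j \<and> j < length l \<and> gap l j = g}"

lemma finite_gap_positions: "finite {j. 1 \<le> j \<and> j < length l \<and> gap l j = g}"
  by (rule finite_subset [of _ "{..<length l}"]) auto

lemma sum_gap_count_le: "(\<Sum>g<G. gap_count l g) \<le> length l - 1"
proof -
  have "(\<Sum>g<G. gap_count l g) = card (\<Union>g<G. {j. 1 \<le> j \<and> j < length l \<and> gap l j = g})"
    unfolding gap_count_def
    by (rule card_UN_disjoint [symmetric]) (auto simp: finite_gap_positions)
  also have "\<dots> \<le> card {1..<length l}"
    by (intro card_mono) auto
  finally show ?thesis by simp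
qed

text \<open>The positions differ even if \<open>a = b\<close>: once one occurrence of
  \<open>a\<close> is removed, the rest of the list still contains \<open>b\<close>. This is what
  gaps of length 0 require.\<close>

lemma subset_mset_pair_nth:
  assumes "{#a, b#} \<subseteq># mset l"
  obtains i j where "i \<noteq> j" "i < length l" "j < length l" "l ! i = a" "l ! j = b"
proof -
  have "a \<in># mset l"
    using mset_subset_eqD [OF assms] by simp
  then obtain xs ys where l: "l = xs @ a # ys"
    by (auto dest: split_list)
  then have "b \<in># mset (xs @ ys)"
    using assms by simp
  then consider "b \<in> set xs" | "b \<in> set ys"
    by auto
  then show thesis
  proof cases
    case 1
    then obtain k where "k < length xs" "xs ! k = b"
      by (auto simp: in_set_conv_nth)
    then show thesis
      by (intro that [of "length xs" k]) (auto simp: l nth_append)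
  next
    case 2
    then obtain k where "k < length ys" "ys ! k = b"
      by (auto simp: in_set_conv_nth)
    then show thesis
      by (intro that [of "length xs" "Suc (length xs + k)"]) (auto simp: l nth_append)
  qed
qed

text \<open>Take positions \<open>p < r\<close> carrying \<open>j\<close> and \<open>j + g\<close>
  with \<open>r - p\<close> minimal. By sortedness the entry after \<open>p\<close> lies between
  \<open>j\<close> and \<open>j + g\<close>; no index strictly between occurs, so it equals one of
  the two, which contradicts minimality unless \<open>r = Suc p\<close>.\<close>

lemma has_gap_at_imp_consecutive:
  assumes "sorted l" "has_gap_at l j g"
  shows "\<exists>i. Suc i < length l \<and> l ! i = j \<and> l ! Suc i = j + g"
proof -
  define Q where "Q = (\<lambda>p r. p < r \<and> r < length l \<and> l ! p = j \<and> l ! r = j + g)"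
  have "{#j, j + g#} \<subseteq># mset l"
    using assms by (simp add: has_gap_at_def)
  then obtain p r where pr: "p \<noteq> r" "p < length l" "r < length l" "l ! p = j" "l ! r = j + g"
    by (rule subset_mset_pair_nth)
  have "\<exists>p r. Q p r"
  proof (cases "p < r")
    case True
    then show ?thesis using pr by (auto simp: Q_def)
  next
    \<comment> \<open>Here \<open>r < p\<close>, so sortedness gives \<open>j + g \<le> j\<close>.
      Thus \<open>g = 0\<close>, both entries are equal, and the positions may be exchanged.\<close>
    case False
    then have "l ! r \<le> l ! p"
      using pr assms by (intro sorted_nth_mono) auto
    then have "Q r p" using False pr by (auto simp: Q_def)
    then show ?thesis by blast
  qed
  then obtain d where "\<exists>p r. Q p r \<and> r - p = d" by blast
  then obtain p r where Q: "Q p r" and least: "\<And>p' r'. Q p' r' \<Longrightarrow> r - p \<le> r' - p'"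
    using exists_least_iff [of "\<lambda>d. \<exists>p r. Q p r \<and> r - p = d"] by (metis not_le_imp_less)
  have "r = Suc p"
  proof (rule ccontr)
    assume "r \<noteq> Suc p"
    then have lt: "Suc p < r" using Q by (auto simp: Q_def)
    then have "j \<le> l ! Suc p" "l ! Suc p \<le> j + g"
      using Q assms sorted_nth_mono [of l p "Suc p"] sorted_nth_mono [of l "Suc p" r]
      by (auto simp: Q_def)
    moreover have "l ! Suc p \<in> set l"
      using lt Q by (auto simp: Q_def)
    ultimately have "l ! Suc p = j \<or> l ! Suc p = j + g"
      using assms(2) [unfolded has_gap_at_def, THEN conjunct2, THEN spec, of "l ! Suc p - j"]
      by (cases "l ! Suc p = j"; cases "l ! Suc p = j + g") auto
    then have "Q (Suc p) r \<or> Q p (Suc p)"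
      using lt Q by (auto simp: Q_def)
    then show False
      using least [of "Suc p" r] least [of p "Suc p"] lt by auto
  qed
  with Q show ?thesis by (auto simp: Q_def)
qed

lemma has_gap_at_in_set:
  assumes "has_gap_at l j g" shows "j \<in> set l" "j + g \<in> set l"
proof -
  have "{#j, j + g#} \<subseteq># mset l" using assms by (simp add: has_gap_at_def)
  then have "set_mset {#j, j + g#} \<subseteq> set_mset (mset l)" by (rule set_mset_mono)
  then show "j \<in> set l" "j + g \<in> set l" by auto
qed

lemma finite_has_gap_at: "finite {j. has_gap_at l j g}"
  by (rule finite_subset [of _ "set l"]) (auto dest: has_gap_at_in_set)

text \<open>The inequality is strict exactly when \<open>g = 0\<close> and some index occurs more than twice.\<close>

lemma card_has_gap_at_le:
  assumes "sorted l"
  shows "card {j. has_gap_at l j g} \<le> gap_count l g"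
proof -
  let ?A = "{j. 1 \<le> j \<and> j < length l \<and> gap l j = g}"
  have "{j. has_gap_at l j g} \<subseteq> (\<lambda>i. l ! (i - 1)) ` ?A"
  proof clarify
    fix j assume "has_gap_at l j g"
    then obtain i where "Suc i < length l" "l ! i = j" "l ! Suc i = j + g"
      using has_gap_at_imp_consecutive assms by blast
    then show "j \<in> (\<lambda>i. l ! (i - 1)) ` ?A"
      by (intro image_eqI [of _ _ "Suc i"]) (auto simp: gap_def)
  qed
  then have "card {j. has_gap_at l j g} \<le> card ((\<lambda>i. l ! (i - 1)) ` ?A)"
    by (intro card_mono finite_imageI finite_gap_positions)
  also have "\<dots> \<le> card ?A"
    by (rule card_image_le [OF finite_gap_positions])
  finally show ?thesis by (simp add: gap_count_def)
qed

text \<open>After swapping the second set, both become disjoint parts of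
  \<open>A \<times> B\<close>, above and below the diagonal. The diagonal is lost, hence only an
  inequality.\<close>

lemma card_less_pairs_add_le:
  fixes A B :: "'a::linorder set"
  assumes "finite A" "finite B"
  shows "card {(a, b). a \<in> A \<and> b \<in> B \<and> a < b} + card {(b, a). b \<in> B \<and> a \<in> A \<and> b < a}
       \<le> card A * card B"
proof -
  let ?L = "{(a, b). a \<in> A \<and> b \<in> B \<and> a < b}" and ?R = "{(b, a). b \<in> B \<and> a \<in> A \<and> b < a}"
  have sub: "?L \<union> prod.swap ` ?R \<subseteq> A \<times> B" by auto
  then have fin: "finite ?L" "finite (prod.swap ` ?R)"
    using assms by (meson finite_SigmaI finite_subset le_sup_iff)+
  have "card ?L + card (prod.swap ` ?R) = card (?L \<union> prod.swap ` ?R)"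
    using fin by (intro card_Un_disjoint [symmetric]) auto
  also have "\<dots> \<le> card (A \<times> B)"
    using assms sub by (intro card_mono) auto
  finally show ?thesis
    by (simp add: card_image card_cartesian_product)
qed

text \<open>For equal factors the two halves are mirror images and the diagonal has
  \<open>card A\<close> elements. The exact count is what yields second moments from one-sided pair
  counts.\<close>

lemma card_less_pairs_eq:
  fixes A :: "'a::linorder set"
  assumes "finite A"
  shows "2 * card {(a, b). a \<in> A \<and> b \<in> A \<and> a < b} + card A = card A * card A"
proof -
  let ?L = "{(a, b). a \<in> A \<and> b \<in> A \<and> a < b}"
  have fin: "finite ?L"
    by (rule finite_subset [of _ "A \<times> A"]) (use assms in auto)
  have eq: "A \<times> A = (?L \<union> prod.swap ` ?L) \<union> (\<lambda>a. (a, a)) ` A"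
    using linorder_less_linear by (auto simp: image_iff)
  have "card A * card A = card ((?L \<union> prod.swap ` ?L) \<union> (\<lambda>a. (a, a)) ` A)"
    by (metis eq card_cartesian_product)
  also have "\<dots> = card (?L \<union> prod.swap ` ?L) + card ((\<lambda>a. (a, a)) ` A)"
    using fin assms by (intro card_Un_disjoint) auto
  also have "card (?L \<union> prod.swap ` ?L) = card ?L + card (prod.swap ` ?L)"
    using fin by (intro card_Un_disjoint) auto
  finally show ?thesis
    by (simp add: card_image inj_on_def)
qed

text \<open>Double counting. Only indices occurring in some decomposition contribute, so the
  infinite sum is finite and may be exchanged with the sum over \<open>Z\<close>.\<close>

lemma infsum_two_gap_count:
  assumes "finite Z"
  shows "(\<Sum>\<^sub>\<infinity>(j1, j2)\<in>{(j1, j2). j1 < j2}. real (two_gap_count dec Z j1 g1 j2 g2))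
       = (\<Sum>z\<in>Z. real (card {(j1, j2). j1 \<in> {j. has_gap_at (dec z) j g1} \<and>
                                  j2 \<in> {j. has_gap_at (dec z) j g2} \<and> j1 < j2}))"
proof -
  define J where "J = (\<Union>z\<in>Z. set (dec z))"
  define F where "F = {(j1, j2). j1 \<in> J \<and> j2 \<in> J \<and> j1 < j2}"
  have fin: "finite F"
    by (rule finite_subset [of _ "J \<times> J"]) (use assms in \<open>auto simp: F_def J_def\<close>)
  define R where "R = (\<lambda>z p. has_gap_at (dec z) (fst p) g1 \<and> has_gap_at (dec z) (snd p) g2)"
  have out: "two_gap_count dec Z j1 g1 j2 g2 = 0" if "(j1, j2) \<notin> F" "j1 < j2" for j1 j2
    using that by (force simp: two_gap_count_def F_def J_def card_eq_0_iff dest: has_gap_at_in_set)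
  have "(\<Sum>\<^sub>\<infinity>(j1, j2)\<in>{(j1, j2). j1 < j2}. real (two_gap_count dec Z j1 g1 j2 g2))
      = (\<Sum>\<^sub>\<infinity>(j1, j2)\<in>F. real (two_gap_count dec Z j1 g1 j2 g2))"
    by (rule infsum_cong_neutral) (auto simp: out, auto simp: F_def)
  also have "\<dots> = (\<Sum>(j1, j2)\<in>F. real (two_gap_count dec Z j1 g1 j2 g2))"
    using fin by simp
  also have "\<dots> = (\<Sum>p\<in>F. \<Sum>z\<in>Z. of_bool (R z p))"
    using assms by (intro sum.cong) (auto simp: two_gap_count_def R_def sum_of_bool_eq Int_def)
  also have "\<dots> = (\<Sum>z\<in>Z. \<Sum>p\<in>F. of_bool (R z p))"
    by (rule sum.swap)
  also have "\<dots> = (\<Sum>z\<in>Z. real (card {(j1, j2). j1 \<in> {j. has_gap_at (dec z) j g1} \<and>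
                                  j2 \<in> {j. has_gap_at (dec z) j g2} \<and> j1 < j2}))"
  proof (rule sum.cong [OF refl])
    fix z assume "z \<in> Z"
    then have "F \<inter> {p. R z p} = {(j1, j2). j1 \<in> {j. has_gap_at (dec z) j g1} \<and>
                                  j2 \<in> {j. has_gap_at (dec z) j g2} \<and> j1 < j2}"
      by (auto simp: F_def R_def J_def dest: has_gap_at_in_set)
    then show "(\<Sum>p\<in>F. of_bool (R z p)) = real (card {(j1, j2). j1 \<in> {j. has_gap_at (dec z) j g1} \<and>
                                  j2 \<in> {j. has_gap_at (dec z) j g2} \<and> j1 < j2})"
      using fin by (simp add: sum_of_bool_eq)
  qed
  finally show ?thesis .
qed

text \<open>A gap of length \<open>g\<close> at \<open>j\<close> forces \<open>j + g\<close> to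
  occur in some decomposition, so \<open>g\<close> is at most the largest index in use.\<close>

lemma finite_two_gap_support:
  assumes "finite Z"
  shows "finite {(g1, g2). (\<Sum>\<^sub>\<infinity>(j1, j2)\<in>{(j1, j2). j1 < j2}.
                   real (two_gap_count dec Z j1 g1 j2 g2)) \<noteq> 0}"
proof (rule finite_subset)
  define J where "J = (\<Union>z\<in>Z. set (dec z))"
  have fin: "finite J" using assms by (auto simp: J_def)
  show "finite ({..Max J} \<times> {..Max J})" by simp
  show "{(g1, g2). (\<Sum>\<^sub>\<infinity>(j1, j2)\<in>{(j1, j2). j1 < j2}.
           real (two_gap_count dec Z j1 g1 j2 g2)) \<noteq> 0} \<subseteq> {..Max J} \<times> {..Max J}"
  proof clarify
    fix g1 g2
    assume "(\<Sum>\<^sub>\<infinity>(j1, j2)\<in>{(j1, j2). j1 < j2}. real (two_gap_count dec Z j1 g1 j2 g2)) \<noteq> 0"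
    then obtain z where "z \<in> Z" "card {(j1, j2). j1 \<in> {j. has_gap_at (dec z) j g1} \<and>
                                  j2 \<in> {j. has_gap_at (dec z) j g2} \<and> j1 < j2} \<noteq> 0"
      unfolding infsum_two_gap_count [OF assms] 
      by (rule sum.not_neutral_contains_not_neutral) simp
    then obtain j1 j2 where "has_gap_at (dec z) j1 g1" "has_gap_at (dec z) j2 g2"
      by (auto simp: card_eq_0_iff)
    then have "j1 + g1 \<in> J" "j2 + g2 \<in> J"
      using \<open>z \<in> Z\<close> has_gap_at_in_set(2) unfolding J_def by blast+
    then show "g1 \<in> {..Max J} \<and> g2 \<in> {..Max J}"
      by (auto intro: add_leD2 [OF Max_ge [OF fin]])
  qed
qed

section \<open>Distribution functions of measures on the natural numbers\<close>

text \<open>Distribution function of the measure with mass \<open>p g\<close> at each natural number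
  \<open>g\<close>. Negative \<open>x\<close> is split off because \<open>nat\<close> would send its
  floor to 0 and count \<open>p 0\<close>.\<close>

definition step_cdf :: "(nat \<Rightarrow> real) \<Rightarrow> real \<Rightarrow> real" where
  "step_cdf p x = (if x < 0 then 0 else \<Sum>g\<le>nat \<lfloor>x\<rfloor>. p g)"

lemma tendsto_step_cdf:
  assumes "\<And>g. (\<lambda>n. p n g) \<longlonglongrightarrow> q g"
  shows "(\<lambda>n. step_cdf (p n) x) \<longlonglongrightarrow> step_cdf q x"
  using assms by (auto simp: step_cdf_def intro!: tendsto_sum)

lemma cdf_dirac_average:
  assumes "finite S" "card S = N"
  shows "cdf (dirac_average N S (\<lambda>i. real (f i))) x
       = step_cdf (\<lambda>g. real (card {i\<in>S. f i = g}) / real N) x"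
proof -
  have sum: "(\<Sum>i\<in>S. indicator {..x} (real (f i)) :: ennreal) = of_nat (card {i\<in>S. real (f i) \<le> x})"
    using assms(1) by (simp add: indicator_def sum.If_cases Int_def)
  have emeasure: "emeasure (dirac_average N S (\<lambda>i. real (f i))) {..x}
      = of_nat (card {i\<in>S. real (f i) \<le> x}) / of_nat N"
    by (subst emeasure_dirac_average) (simp_all add: sum)
  have cdf: "cdf (dirac_average N S (\<lambda>i. real (f i))) x = real (card {i\<in>S. real (f i) \<le> x}) / real N"
  \<comment> \<open>A decomposition with a single summand has no gaps: the measure is null and the
    quotients are \<open>0 / 0 = 0\<close>, so the formula persists.\<close>
  proof (cases "N = 0")
    case True
    then have "S = {}" using assms by simp
    then show ?thesis using emeasure True by (simp add: cdf_def measure_def)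
  next
    case False
    then show ?thesis
      using emeasure by (simp add: cdf_def measure_def divide_ennreal ennreal_of_nat_eq_real_of_nat)
  qed
  show ?thesis
  proof (cases "x < 0")
    case True
    then have "{i\<in>S. real (f i) \<le> x} = {}" by auto
    then have "card {i\<in>S. real (f i) \<le> x} = 0" by (simp only: card.empty)
    then show ?thesis using True by (simp add: cdf step_cdf_def)
  next
    case False
    then have "{i\<in>S. real (f i) \<le> x} = (\<Union>g\<le>nat \<lfloor>x\<rfloor>. {i\<in>S. f i = g})"
      by (auto simp: le_nat_iff le_floor_iff)
    also have "card \<dots> = (\<Sum>g\<le>nat \<lfloor>x\<rfloor>. card {i\<in>S. f i = g})"
      using assms(1) by (intro card_UN_disjoint) auto
    finally show ?thesis
      using False by (simp add: cdf step_cdf_def sum_divide_distrib)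
  qed
qed

lemma cdf_individual_gap_measure:
  "cdf (individual_gap_measure l) x
     = step_cdf (\<lambda>g. real (gap_count l g) / real (length l - 1)) x"
proof -
  have "{j \<in> {1..<length l}. gap l j = g} = {j. 1 \<le> j \<and> j < length l \<and> gap l j = g}" for g
    by auto
  then show ?thesis
    unfolding individual_gap_measure_def
    by (subst cdf_dirac_average) (simp_all add: gap_count_def)
qed

lemma card_gaps_eq_sum_gap_count:
  assumes "finite Z"
  shows "card {(z, j). z \<in> Z \<and> 1 \<le> j \<and> j < length (dec z) \<and> gap (dec z) j = g}
       = (\<Sum>z\<in>Z. gap_count (dec z) g)"
proof -
  have "{(z, j). z \<in> Z \<and> 1 \<le> j \<and> j < length (dec z) \<and> gap (dec z) j = g}
      = (SIGMA z:Z. {j. 1 \<le> j \<and> j < length (dec z) \<and> gap (dec z) j = g})"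
    by auto
  then show ?thesis
    using assms by (simp add: gap_count_def card_SigmaI finite_gap_positions del: One_nat_def)
qed

lemma cdf_average_gap_measure:
  assumes "finite Z"
  shows "cdf (average_gap_measure dec Z) x = step_cdf (gap_proportion dec Z) x"
proof -
  have "{p \<in> SIGMA z:Z. {1..<length (dec z)}. gap (dec (fst p)) (snd p) = g}
      = {(z, j). z \<in> Z \<and> 1 \<le> j \<and> j < length (dec z) \<and> gap (dec z) j = g}" for g
    by auto
  then show ?thesis
    using assms unfolding average_gap_measure_def case_prod_unfold
    by (subst cdf_dirac_average) (simp_all add: gap_proportion_def [abs_def] num_gaps_def card_SigmaI case_prod_unfold)
qed

text \<open>Convergence of the masses alone would let mass escape to infinity; the limit being a
  probability measure prevents this. Atoms are countable, so each interval \<open>(n, n + 1)\<close>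
  contains a continuity point, at which the distribution function is the partial sum of
  \<open>P\<close> up to \<open>n\<close>.\<close>

lemma weak_limit_of_step_cdfs:
  assumes "real_distribution \<nu>" and weak: "weak_conv_m M \<nu>"
    and cdf_M: "\<forall>\<^sub>F n in sequentially. cdf (M n) = step_cdf (q n)"
    and q: "\<And>g. (\<lambda>n. q n g) \<longlonglongrightarrow> P g"
  shows weak_limit_cdf_eq: "\<And>x. isCont (cdf \<nu>) x \<Longrightarrow> cdf \<nu> x = step_cdf P x"
    and weak_limit_sums_1: "P sums 1"
proof -
  interpret \<nu>: real_distribution \<nu> by fact
  show cdf_eq: "cdf \<nu> x = step_cdf P x" if "isCont (cdf \<nu>) x" for x
  proof -
    have "(\<lambda>n. cdf (M n) x) \<longlonglongrightarrow> cdf \<nu> x"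
      using weak that by (auto simp: weak_conv_m_def weak_conv_def)
    moreover have "(\<lambda>n. cdf (M n) x) \<longlonglongrightarrow> step_cdf P x"
      by (rule Lim_transform_eventually [OF tendsto_step_cdf [OF q]])
        (use cdf_M in eventually_elim, simp)
    ultimately show ?thesis
      by (rule LIMSEQ_unique)
  qed
  have "\<exists>x. real n < x \<and> x < real n + 1 \<and> isCont (cdf \<nu>) x" for n
  proof (rule ccontr)
    assume "\<not> ?thesis"
    then have "{real n<..<real n + 1} \<subseteq> {x. measure \<nu> {x} > 0}"
      by (auto simp: \<nu>.isCont_cdf zero_less_measure_iff)
    then have "countable {real n<..<real n + 1}"
      using \<nu>.countable_atoms countable_subset by blast
    then show False
      using uncountable_open_interval [of "real n" "real n + 1"] by simp
  qed
  then obtain x where x: "\<And>n. real n < x n" "\<And>n. x n < real n + 1" "\<And>n. isCont (cdf \<nu>) (x n)"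
    by metis
  have "filterlim x at_top sequentially"
    by (rule filterlim_at_top_mono [OF filterlim_real_sequentially])
      (use x(1) in \<open>auto intro!: always_eventually less_imp_le\<close>)
  then have "(\<lambda>n. cdf \<nu> (x n)) \<longlonglongrightarrow> 1"
    by (rule filterlim_compose [OF \<nu>.cdf_lim_at_top_prob])
  moreover have "cdf \<nu> (x n) = (\<Sum>g\<le>n. P g)" for n
  proof -
    have "\<lfloor>x n\<rfloor> = int n"
      using x(1,2) [of n] by (simp add: floor_eq_iff)
    moreover have "\<not> x n < 0"
      using x(1) [of n] of_nat_0_le_iff [of n, where ?'a = real] by linarith
    ultimately show ?thesis
      by (simp add: cdf_eq [OF x(3)] step_cdf_def)
  qed
  ultimately show "P sums 1"
    by (simp add: sums_def_le)
qed

section \<open>Convergence of the gap measures\<close>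

lemma linear_growth_ratio:
  assumes "(\<lambda>n. f n - c * real n) \<in> O(\<lambda>_. 1)"
  shows "(\<lambda>n. f n / real n) \<longlonglongrightarrow> (c :: real)"
proof -
  obtain K where K: "\<forall>\<^sub>F n in sequentially. norm (f n - c * real n) \<le> K * norm (1 :: real)"
    using assms by (rule landau_o.bigE)
  have "(\<lambda>n. (f n - c * real n) / real n) \<longlonglongrightarrow> 0"
  proof (rule Lim_null_comparison)
    show "\<forall>\<^sub>F n in sequentially. norm ((f n - c * real n) / real n) \<le> K / real n"
      using K by eventually_elim (simp add: divide_right_mono)
    show "(\<lambda>n. K / real n) \<longlonglongrightarrow> 0"
      by (rule lim_const_over_n)
  qed
  then have "(\<lambda>n. (f n - c * real n) / real n + c) \<longlonglongrightarrow> c"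
    using tendsto_add [OF _ tendsto_const] by fastforce
  then show ?thesis
    by (rule Lim_transform_eventually)
      (use eventually_gt_at_top [of 0] in eventually_elim, simp add: field_simps)
qed

text \<open>The summability established here matters: an infinite sum that does not converge is \<open>0\<close>
  by convention, so the hypothesis on \<open>err\<close> alone would carry no information.\<close>

lemma error_tendsto_0:
  fixes P :: "nat \<Rightarrow> real"
  assumes P: "\<And>g. 0 \<le> P g" "summable P"
    and T: "\<And>n g h. n > 0 \<Longrightarrow> T g h n = P g * P h + err n g h"
    and fin: "\<And>n. n > 0 \<Longrightarrow> finite {(g, h). T g h n \<noteq> 0}"
    and lim: "(\<lambda>n. \<Sum>\<^sub>\<infinity>(g, h)\<in>UNIV. \<bar>err n g h\<bar>) \<longlonglongrightarrow> 0"
  shows "(\<lambda>n. err n g h) \<longlonglongrightarrow> 0"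
proof (rule Lim_null_comparison [OF _ lim])
  have P_on: "P summable_on UNIV"
    using P by (simp add: summable_on_UNIV_nonneg_real_iff)
  have PP: "(\<lambda>p. norm ((\<lambda>(g, h). P g * P h) p)) summable_on UNIV \<times> UNIV"
    using P P_on
    by (subst Infinite_Sum.abs_summable_on_Sigma_iff)
      (auto simp: abs_mult infsum_cmult_right' infsum_nonneg
        intro!: summable_on_cmult_right summable_on_cmult_left)
  show "\<forall>\<^sub>F n in sequentially. norm (err n g h) \<le> (\<Sum>\<^sub>\<infinity>(g, h)\<in>UNIV. \<bar>err n g h\<bar>)"
    using eventually_gt_at_top [of 0]
  proof eventually_elim
    case (elim n)
    \<comment> \<open>\<open>err\<close> is the difference of \<open>T\<close>, which has finite
      support, and the summable product of \<open>P\<close> with itself. Hence it is absolutely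
      summable and each term is bounded by the total.\<close>
    have "(\<lambda>(g, h). \<bar>T g h n\<bar>) summable_on UNIV"
      by (rule finite_nonzero_values_imp_summable_on) (use fin [OF elim] in \<open>simp add: case_prod_unfold\<close>)
    then have "(\<lambda>p. \<bar>T (fst p) (snd p) n\<bar> + norm (P (fst p) * P (snd p))) summable_on UNIV"
      using PP by (intro summable_on_add) (simp_all add: case_prod_unfold)
    then have "(\<lambda>p. norm (err n (fst p) (snd p))) summable_on UNIV"
    proof (rule Infinite_Sum.abs_summable_on_comparison_test')
      fix p
      show "norm (err n (fst p) (snd p)) \<le> \<bar>T (fst p) (snd p) n\<bar> + norm (P (fst p) * P (snd p))"
        using T [OF elim, of "fst p" "snd p"] by simp
    qed
    then have "sum (\<lambda>p. \<bar>err n (fst p) (snd p)\<bar>) {(g, h)}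
        \<le> infsum (\<lambda>p. \<bar>err n (fst p) (snd p)\<bar>) UNIV"
      by (intro finite_sum_le_infsum) simp_all
    then show ?case
      by (simp add: case_prod_unfold)
  qed
qed

text \<open>\<open>T g h\<close> is twice the mean number of pairs \<open>j1 < j2\<close> of gap
  positions, over \<open>m\<^sup>2\<close>. Both orders together miss only the pairs with
  \<open>j1 = j2\<close>; for \<open>g = h\<close> these number exactly \<open>H g\<close>, which
  gives the extra term.\<close>

lemma has_gap_pair_mean_bounds:
  fixes dec :: "nat \<Rightarrow> nat list" and m :: real and Z :: "nat set"
  defines "H \<equiv> \<lambda>g z. real (card {j. has_gap_at (dec z) j g})"
    and "T \<equiv> \<lambda>g h. 2 / (real (card Z) * m\<^sup>2) *
      (\<Sum>\<^sub>\<infinity>(j1, j2)\<in>{(j1, j2). j1 < j2}. real (two_gap_count dec Z j1 g j2 h))"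
  assumes "finite Z"
  shows two_gap_sum_le: "T g h + T h g \<le> 2 * mean_on Z (\<lambda>z. H g z / m * (H h z / m))"
    and two_gap_sum_diagonal: "mean_on Z (\<lambda>z. (H g z / m)\<^sup>2) = T g g + mean_on Z (H g) / m\<^sup>2"
proof -
  define L where "L = (\<lambda>g h z. real (card {(j1, j2). j1 \<in> {j. has_gap_at (dec z) j g} \<and>
                                  j2 \<in> {j. has_gap_at (dec z) j h} \<and> j1 < j2}))"
  have T: "T g h = 2 * mean_on Z (L g h) / m\<^sup>2" for g h
    unfolding T_def infsum_two_gap_count [OF \<open>finite Z\<close>] by (simp add: mean_on_def L_def)
  have "L g h z + L h g z \<le> H g z * H h z" for z
    unfolding L_def H_def of_nat_add [symmetric] of_nat_mult [symmetric] of_nat_le_iff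
    by (rule card_less_pairs_add_le) (rule finite_has_gap_at)+
  then have "mean_on Z (L g h) + mean_on Z (L h g) \<le> mean_on Z (\<lambda>z. H g z * H h z)"
    unfolding mean_on_add [symmetric] by (rule mean_on_mono)
  then have "2 * (mean_on Z (L g h) + mean_on Z (L h g)) / m\<^sup>2 \<le> 2 * mean_on Z (\<lambda>z. H g z * H h z) / m\<^sup>2"
    by (intro divide_right_mono) auto
  then show "T g h + T h g \<le> 2 * mean_on Z (\<lambda>z. H g z / m * (H h z / m))"
    by (simp add: T mean_on_divide power2_eq_square add_divide_distrib)
  have "H g z * H g z = 2 * L g g z + H g z" for z
    using card_less_pairs_eq [OF finite_has_gap_at, of "dec z" g]
    unfolding L_def H_def by (simp flip: of_nat_mult of_nat_add)
  then show "mean_on Z (\<lambda>z. (H g z / m)\<^sup>2) = T g g + mean_on Z (H g) / m\<^sup>2"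
    by (simp add: T power2_eq_square mean_on_divide mean_on_add mean_on_cmult add_divide_distrib)
qed
theorem theorem1p1:
  fixes b :: "nat \<Rightarrow> nat" and legal :: "nat list \<Rightarrow> bool"
    and c1 d1 c2 d2 :: int
    and c_mean c_var C :: real
    and P :: "nat \<Rightarrow> real" and \<nu> :: "real measure"
    and err :: "nat \<Rightarrow> nat \<Rightarrow> nat \<Rightarrow> real"
  defines "dec \<equiv> decomp b legal"
    and "I \<equiv> int_interval b c1 d1 c2 d2"
  defines "\<mu> \<equiv> \<lambda>n. measure_pmf.expectation (pmf_of_set (I n)) (\<lambda>z. real (length (dec z)))"
    and "\<sigma>2 \<equiv> \<lambda>n. measure_pmf.variance (pmf_of_set (I n)) (\<lambda>z. real (length (dec z)))"
  assumes b_pos: "\<And>i. b i > 0"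
    and unique: "unique_decompositions b legal"
    and well_defined: "\<And>n. n > 0 \<Longrightarrow> 0 \<le> c1 * int n + d1 \<and> 0 \<le> c2 * int n + d2 \<and> I n \<noteq> {}"
    and c_pos: "c_mean > 0" "c_var > 0"
    and gaussian: "weak_conv_m
          (\<lambda>n. distr (measure_pmf (pmf_of_set (I n))) borel
                 (\<lambda>z. (real (length (dec z)) - \<mu> n) / sqrt (\<sigma>2 n)))
          std_normal_distribution"
    and mean: "(\<lambda>n. \<mu> n - c_mean * real n) \<in> O(\<lambda>_. 1)"
    and variance: "(\<lambda>n. \<sigma>2 n - c_var * real n) \<in> O(\<lambda>_. 1)"
    and k_bound: "\<And>n z. n > 0 \<Longrightarrow> z \<in> I n \<Longrightarrow> real (length (dec z)) \<le> C * real n"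
    and nu_prob: "real_distribution \<nu>"
    and nu_limit: "weak_conv_m (\<lambda>n. average_gap_measure dec (I n)) \<nu>"
    and P_limit: "\<And>g. (\<lambda>n. gap_proportion dec (I n) g) \<longlonglongrightarrow> P g"
    and two_gaps: "\<And>n g1 g2. n > 0 \<Longrightarrow>
          2 / (real (card (I n)) * (\<mu> n)\<^sup>2)
            * (\<Sum>\<^sub>\<infinity>(j1, j2)\<in>{(j1, j2). j1 < j2}. real (two_gap_count dec (I n) j1 g1 j2 g2))
          = P g1 * P g2 + err n g1 g2"
    and err_limit: "(\<lambda>n. \<Sum>\<^sub>\<infinity>(g1, g2)\<in>UNIV. \<bar>err n g1 g2\<bar>) \<longlonglongrightarrow> 0"
  shows "\<exists>A. (\<forall>n>0. A n \<subseteq> I n) \<and>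
             (\<lambda>n. real (card (A n)) / real (card (I n))) \<longlonglongrightarrow> 1 \<and>
             (\<forall>\<zeta>. (\<forall>\<^sub>F n in sequentially. \<zeta> n \<in> A n) \<longrightarrow>
                   weak_conv_m (\<lambda>n. individual_gap_measure (dec (\<zeta> n))) \<nu>)"
proof -
  have I: "finite (I n) \<and> I n \<noteq> {}" if "n > 0" for n
    using well_defined [OF that] by (simp add: I_def int_interval_def)
  \<comment> \<open>Positivity of \<open>b\<close> makes every \<open>z\<close> in
    \<open>I n\<close> positive, so its decomposition is the unique one and cannot be empty.\<close>
  have dec: "sorted (dec z) \<and> length (dec z) \<ge> 1" if "z \<in> I n" for n z
  proof -
    have "b (nat (c1 * int n + d1)) \<le> z"
      using that by (simp add: I_def int_interval_def)
    then have "z > 0"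
      using b_pos by (meson less_le_trans)
    then have "decomposition_of b legal z (dec z)"
      unfolding dec_def by (rule decomp_eq_iff [OF unique, THEN iffD1, OF _ refl])
    then show ?thesis
      using \<open>z > 0\<close> by (cases "dec z") (auto simp: decomposition_of_def)
  qed

  \<comment> \<open>Mean and variance of the number of summands\<close>
  define k where "k = (\<lambda>z. real (length (dec z)))"
  have \<mu>: "\<mu> n = mean_on (I n) k" if "n > 0" for n
    using I [OF that] by (simp add: \<mu>_def mean_on_def integral_pmf_of_set k_def)
  have \<sigma>2: "\<sigma>2 n = mean_on (I n) (\<lambda>z. (k z)\<^sup>2) - (\<mu> n)\<^sup>2" if "n > 0" for n
  proof -
    have "\<sigma>2 n = mean_on (I n) (\<lambda>z. (k z - \<mu> n)\<^sup>2)"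
      using I [OF that] by (simp add: \<sigma>2_def \<mu>_def mean_on_def integral_pmf_of_set k_def)
    also have "\<dots> = mean_on (I n) (\<lambda>z. (k z)\<^sup>2 - (2 * \<mu> n) * k z + (\<mu> n)\<^sup>2)"
      by (simp add: power2_diff algebra_simps)
    also have "\<dots> = mean_on (I n) (\<lambda>z. (k z)\<^sup>2) - (\<mu> n)\<^sup>2"
      using I [OF that] \<mu> [OF that, symmetric]
      by (simp add: mean_on_add mean_on_diff mean_on_cmult mean_on_const power2_eq_square)
    finally show ?thesis .
  qed
  have \<mu>_ge_1: "1 \<le> \<mu> n" if "n > 0" for n
    unfolding \<mu> [OF that] using I [OF that] dec mean_on_mono [of "I n" "\<lambda>_. 1" k]
    by (simp add: mean_on_const k_def)
  have inverse_\<mu>: "(\<lambda>n. 1 / \<mu> n) \<longlonglongrightarrow> 0"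
  proof -
    have "(\<lambda>n. (1 / real n) / (\<mu> n / real n)) \<longlonglongrightarrow> 0 / c_mean"
      using c_pos by (intro tendsto_divide linear_growth_ratio mean lim_const_over_n) auto
    then have "(\<lambda>n. (1 / real n) / (\<mu> n / real n)) \<longlonglongrightarrow> 0"
      by (simp only: div_0)
    then show ?thesis
      by (rule Lim_transform_eventually)
        (use eventually_gt_at_top [of 0] in eventually_elim, simp)
  qed
  \<comment> \<open>The variance grows linearly in \<open>n\<close>, the squared mean
    quadratically.\<close>
  have \<sigma>2_ratio: "(\<lambda>n. \<sigma>2 n / (\<mu> n)\<^sup>2) \<longlonglongrightarrow> 0"
  proof -
    have "(\<lambda>n. (\<sigma>2 n / real n) / (\<mu> n / real n) * (1 / \<mu> n)) \<longlonglongrightarrow> c_var / c_mean * 0"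
      using c_pos
      by (intro tendsto_divide tendsto_mult linear_growth_ratio mean variance inverse_\<mu>) auto
    then have "(\<lambda>n. (\<sigma>2 n / real n) / (\<mu> n / real n) * (1 / \<mu> n)) \<longlonglongrightarrow> 0"
      by (simp only: mult_zero_right)
    then show ?thesis
      by (rule Lim_transform_eventually)
        (use eventually_gt_at_top [of 0] in eventually_elim, simp add: power2_eq_square)
  qed

  \<comment> \<open>Normalized gap counts and their moments\<close>
  define \<kappa> where "\<kappa> = (\<lambda>n z. real (length (dec z) - 1) / \<mu> n)"
  define x where "x = (\<lambda>g n z. real (gap_count (dec z) g) / \<mu> n)"
  define H where "H = (\<lambda>g z. real (card {j. has_gap_at (dec z) j g}))"
  define s where "s = (\<lambda>g n z. H g z / \<mu> n)"
  define T where "T = (\<lambda>g h n. 2 / (real (card (I n)) * (\<mu> n)\<^sup>2) *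
      (\<Sum>\<^sub>\<infinity>(j1, j2)\<in>{(j1, j2). j1 < j2}. real (two_gap_count dec (I n) j1 g j2 h)))"

  have len: "real (length (dec z) - 1) = k z - 1" if "z \<in> I n" for z n
    using dec [OF that] by (simp add: k_def of_nat_diff)
  have mean_len: "mean_on (I n) (\<lambda>z. real (length (dec z) - 1)) = \<mu> n - 1" if "n > 0" for n
  proof -
    have "mean_on (I n) (\<lambda>z. real (length (dec z) - 1)) = mean_on (I n) (\<lambda>z. k z - 1)"
      unfolding mean_on_def using len by simp
    then show ?thesis
      using I [OF that] by (simp add: mean_on_diff mean_on_const \<mu> that)
  qed
  have mean_\<kappa>: "(\<lambda>n. mean_on (I n) (\<kappa> n)) \<longlonglongrightarrow> 1"
  proof (rule Lim_transform_eventually)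
    show "(\<lambda>n. 1 - 1 / \<mu> n) \<longlonglongrightarrow> 1"
      using tendsto_diff [OF tendsto_const inverse_\<mu>] by simp
    show "\<forall>\<^sub>F n in sequentially. 1 - 1 / \<mu> n = mean_on (I n) (\<kappa> n)"
      using eventually_gt_at_top [of 0]
    proof eventually_elim
      case (elim n)
      then show ?case
        using \<mu>_ge_1 [OF elim] mean_len [OF elim]
        by (simp add: \<kappa>_def mean_on_divide diff_divide_distrib)
    qed
  qed
  have mean_\<kappa>2: "(\<lambda>n. mean_on (I n) (\<lambda>z. (\<kappa> n z)\<^sup>2)) \<longlonglongrightarrow> 1"
  proof (rule Lim_transform_eventually)
    show "(\<lambda>n. \<sigma>2 n / (\<mu> n)\<^sup>2 + 1 - 2 * (1 / \<mu> n) + (1 / \<mu> n)\<^sup>2) \<longlonglongrightarrow> 1"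
      by (rule tendsto_eq_intros \<sigma>2_ratio inverse_\<mu> | simp)+
    show "\<forall>\<^sub>F n in sequentially. \<sigma>2 n / (\<mu> n)\<^sup>2 + 1 - 2 * (1 / \<mu> n) + (1 / \<mu> n)\<^sup>2
        = mean_on (I n) (\<lambda>z. (\<kappa> n z)\<^sup>2)"
      using eventually_gt_at_top [of 0]
    proof eventually_elim
      case (elim n)
      have "mean_on (I n) (\<lambda>z. (\<kappa> n z)\<^sup>2) = mean_on (I n) (\<lambda>z. ((k z)\<^sup>2 + 1 - 2 * k z) / (\<mu> n)\<^sup>2)"
        unfolding mean_on_def \<kappa>_def
        by (simp add: len power_divide power2_diff del: One_nat_def)
      also have "\<dots> = (\<sigma>2 n + (\<mu> n)\<^sup>2 + 1 - 2 * \<mu> n) / (\<mu> n)\<^sup>2"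
        using I [OF elim] \<sigma>2 [OF elim] \<mu> [OF elim]
        by (simp add: mean_on_divide mean_on_add mean_on_diff mean_on_cmult mean_on_const)
      finally show ?case
        using \<mu>_ge_1 [OF elim]
        by (simp add: add_divide_distrib diff_divide_distrib power2_eq_square)
    qed
  qed
  have mean_x: "(\<lambda>n. mean_on (I n) (x g n)) \<longlonglongrightarrow> P g" for g
  proof (rule Lim_transform_eventually)
    \<comment> \<open>The factor converts between the normalization of \<open>gap_proportion\<close>
      by the number of gaps, \<open>card (I n) * (\<mu> n - 1)\<close>, and that of the mean of
      \<open>x\<close> by \<open>card (I n) * \<mu> n\<close>.\<close>
    show "(\<lambda>n. gap_proportion dec (I n) g * (1 - 1 / \<mu> n)) \<longlonglongrightarrow> P g"
      using tendsto_mult [OF P_limit tendsto_diff [OF tendsto_const inverse_\<mu>], of g 1] by simp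
    show "\<forall>\<^sub>F n in sequentially. gap_proportion dec (I n) g * (1 - 1 / \<mu> n) = mean_on (I n) (x g n)"
      using eventually_gt_at_top [of 0]
    proof eventually_elim
      case (elim n)
      have card: "card (I n) > 0"
        using I [OF elim] by (simp add: card_gt_0_iff)
      have gaps: "real (num_gaps dec (I n)) = real (card (I n)) * (\<mu> n - 1)"
        using mean_len [OF elim] card by (simp add: mean_on_def num_gaps_def field_simps)
      \<comment> \<open>Covers the case of no gaps at all, where the proportion is \<open>0\<close>
        by convention and the count must be seen to vanish.\<close>
      have count: "(\<Sum>z\<in>I n. gap_count (dec z) g) \<le> num_gaps dec (I n)"
        unfolding num_gaps_def
      proof (rule sum_mono)
        fix z
        show "gap_count (dec z) g \<le> length (dec z) - 1"
          using sum_gap_count_le [of "dec z" "Suc g"] by simp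
      qed
      have "gap_proportion dec (I n) g
          = real (\<Sum>z\<in>I n. gap_count (dec z) g) / real (num_gaps dec (I n))"
        using I [OF elim] unfolding gap_proportion_def by (subst card_gaps_eq_sum_gap_count) simp_all
      then have "gap_proportion dec (I n) g * real (num_gaps dec (I n))
          = (\<Sum>z\<in>I n. real (gap_count (dec z) g))"
        using count unfolding of_nat_sum [symmetric] by (cases "num_gaps dec (I n) = 0") simp_all
      then have "gap_proportion dec (I n) g * (\<mu> n - 1) = mean_on (I n) (\<lambda>z. real (gap_count (dec z) g))"
        using card by (simp add: gaps mean_on_def field_simps)
      then show ?case
        using \<mu>_ge_1 [OF elim] by (simp add: x_def mean_on_divide field_simps)
    qed
  qed
  have s_le_x: "0 \<le> s g n z \<and> s g n z \<le> x g n z" if "n > 0" "z \<in> I n" for g n z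
    using \<mu>_ge_1 [OF that(1)] card_has_gap_at_le dec [OF that(2)]
    by (simp add: s_def x_def H_def divide_right_mono)
  have x_sum: "(\<Sum>g<G. x g n z) \<le> \<kappa> n z" if "n > 0" "z \<in> I n" for G n z
    using \<mu>_ge_1 [OF that(1)] sum_gap_count_le [of "dec z" G]
    by (simp add: x_def \<kappa>_def divide_right_mono flip: sum_divide_distrib of_nat_sum)

  \<comment> \<open>The limit measure and its masses\<close>
  have cdf_average: "cdf (average_gap_measure dec (I n)) = step_cdf (gap_proportion dec (I n))" if "n > 0" for n
    using I [OF that] by (simp add: cdf_average_gap_measure fun_eq_iff)
  have ev_cdf: "\<forall>\<^sub>F n in sequentially.
      cdf (average_gap_measure dec (I n)) = step_cdf (gap_proportion dec (I n))"
    using eventually_gt_at_top [of 0] by eventually_elim (rule cdf_average)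
  note cdf_\<nu> = weak_limit_cdf_eq [OF nu_prob nu_limit ev_cdf P_limit]
  have P_sums: "P sums 1"
    by (rule weak_limit_sums_1 [OF nu_prob nu_limit ev_cdf P_limit])
  have P_nonneg: "0 \<le> P g" for g
    by (rule LIMSEQ_le_const [OF P_limit]) (auto simp: gap_proportion_def)

  \<comment> \<open>Limits of the two-gap averages\<close>
  have T_eq: "T g h n = P g * P h + err n g h" if "n > 0" for g h n
    using two_gaps [OF that] by (simp add: T_def)
  have err_lim: "(\<lambda>n. err n g h) \<longlonglongrightarrow> 0" for g h
  proof (rule error_tendsto_0 [OF P_nonneg sums_summable [OF P_sums] T_eq _ err_limit])
    fix n :: nat assume "n > 0"
    then show "finite {(g, h). T g h n \<noteq> 0}"
      using I by (intro finite_subset [OF _ finite_two_gap_support [of "I n" dec]]) (auto simp: T_def)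
  qed
  have T_lim: "T g h \<longlonglongrightarrow> P g * P h" for g h
  proof (rule Lim_transform_eventually)
    show "(\<lambda>n. P g * P h + err n g h) \<longlonglongrightarrow> P g * P h"
      using tendsto_add [OF tendsto_const err_lim] by simp
    show "\<forall>\<^sub>F n in sequentially. P g * P h + err n g h = T g h n"
      using eventually_gt_at_top [of 0] by eventually_elim (simp add: T_eq)
  qed
  have T_le: "T g h n + T h g n \<le> 2 * mean_on (I n) (\<lambda>z. s g n z * s h n z)" if "n > 0" for g h n
    unfolding T_def s_def H_def using I [OF that] by (intro two_gap_sum_le) simp
  have mean_s2: "(\<lambda>n. mean_on (I n) (\<lambda>z. (s g n z)\<^sup>2)) \<longlonglongrightarrow> (P g)\<^sup>2" for g
  proof -
    \<comment> \<open>This is the diagonal \<open>j1 = j2\<close>, absent from the sum over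
      \<open>j1 < j2\<close>: being linear in the gap count, it is negligible against
      \<open>(\<mu> n)\<^sup>2\<close>.\<close>
    have small: "(\<lambda>n. mean_on (I n) (s g n) * (1 / \<mu> n)) \<longlonglongrightarrow> 0"
    proof (rule tendsto_sandwich [OF _ _ tendsto_const])
      show "(\<lambda>n. mean_on (I n) (x g n) * (1 / \<mu> n)) \<longlonglongrightarrow> 0"
        using tendsto_mult [OF mean_x inverse_\<mu>] by simp
      show "\<forall>\<^sub>F n in sequentially. mean_on (I n) (s g n) * (1 / \<mu> n) \<le> mean_on (I n) (x g n) * (1 / \<mu> n)"
        using eventually_gt_at_top [of 0]
      proof eventually_elim
        case (elim n)
        then show ?case
          using \<mu>_ge_1 [OF elim] s_le_x by (intro mult_right_mono mean_on_mono) auto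
      qed
      show "\<forall>\<^sub>F n in sequentially. 0 \<le> mean_on (I n) (s g n) * (1 / \<mu> n)"
        using eventually_gt_at_top [of 0]
      proof eventually_elim
        case (elim n)
        then show ?case
          using \<mu>_ge_1 [OF elim] s_le_x by (intro mult_nonneg_nonneg mean_on_nonneg) auto
      qed
    qed
    show ?thesis
    proof (rule Lim_transform_eventually)
      show "(\<lambda>n. T g g n + mean_on (I n) (s g n) * (1 / \<mu> n)) \<longlonglongrightarrow> (P g)\<^sup>2"
        using tendsto_add [OF T_lim small] by (simp add: power2_eq_square)
      show "\<forall>\<^sub>F n in sequentially. T g g n + mean_on (I n) (s g n) * (1 / \<mu> n)
          = mean_on (I n) (\<lambda>z. (s g n z)\<^sup>2)"
        using eventually_gt_at_top [of 0]
      proof eventually_elim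
        case (elim n)
        then show ?case
          using two_gap_sum_diagonal [of "I n" dec g "\<mu> n"] I [OF elim]
          by (simp add: s_def H_def T_def mean_on_divide power2_eq_square)
      qed
    qed
  qed

  \<comment> \<open>Concentration and typical sets\<close>
  have fluct: "(\<lambda>n. mean_on (I n) (\<lambda>z. (x g n z - P g)\<^sup>2)) \<longlonglongrightarrow> 0" for g
    using I s_le_x x_sum mean_\<kappa>2 mean_x mean_s2 T_lim T_le P_sums
    by (rule gap_fluctuation_tendsto_0)
  have fluct_\<kappa>: "(\<lambda>n. mean_on (I n) (\<lambda>z. (\<kappa> n z - 1)\<^sup>2)) \<longlonglongrightarrow> 0"
  proof (rule Lim_transform_eventually)
    show "(\<lambda>n. mean_on (I n) (\<lambda>z. (\<kappa> n z)\<^sup>2) - 2 * mean_on (I n) (\<kappa> n) + 1) \<longlonglongrightarrow> 0"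
      by (rule tendsto_eq_intros mean_\<kappa> mean_\<kappa>2 | simp)+
    show "\<forall>\<^sub>F n in sequentially. mean_on (I n) (\<lambda>z. (\<kappa> n z)\<^sup>2) - 2 * mean_on (I n) (\<kappa> n) + 1
        = mean_on (I n) (\<lambda>z. (\<kappa> n z - 1)\<^sup>2)"
      using eventually_gt_at_top [of 0]
    proof eventually_elim
      case (elim n)
      then show ?case
        using I [OF elim]
        by (simp add: power2_diff mean_on_add mean_on_diff mean_on_cmult mean_on_const)
    qed
  qed

  \<comment> \<open>Collecting \<open>\<kappa>\<close> and all gap lengths in one countable family
    yields a single choice of \<open>A\<close> that works for every \<open>g\<close>.\<close>
  define Y where "Y = (\<lambda>i n z. case i of 0 \<Rightarrow> (\<kappa> n z - 1)\<^sup>2 | Suc g \<Rightarrow> (x g n z - P g)\<^sup>2)"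
  have "0 \<le> Y i n z" for i n z
    by (simp add: Y_def split: nat.split)
  moreover have "(\<lambda>n. mean_on (I n) (Y i n)) \<longlonglongrightarrow> 0" for i
    using fluct fluct_\<kappa> by (cases i) (simp_all add: Y_def)
  ultimately obtain A where A: "\<And>n. A n \<subseteq> I n"
      "(\<lambda>n. real (card (A n)) / real (card (I n))) \<longlonglongrightarrow> 1"
      "\<And>\<zeta> i. \<forall>\<^sub>F n in sequentially. \<zeta> n \<in> A n \<Longrightarrow> (\<lambda>n. Y i n (\<zeta> n)) \<longlonglongrightarrow> 0"
    using mean_tendsto_0_imp_typical [of I Y] I by blast
  have "weak_conv_m (\<lambda>n. individual_gap_measure (dec (\<zeta> n))) \<nu>"
    if \<zeta>: "\<forall>\<^sub>F n in sequentially. \<zeta> n \<in> A n" for \<zeta>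
  proof -
    have \<kappa>_lim: "(\<lambda>n. \<kappa> n (\<zeta> n)) \<longlonglongrightarrow> 1"
      using A(3) [OF \<zeta>, of 0] by (simp add: Y_def tendsto_power2_0_iff LIM_zero_iff)
    have x_lim: "(\<lambda>n. x g n (\<zeta> n)) \<longlonglongrightarrow> P g" for g
      using A(3) [OF \<zeta>, of "Suc g"] by (simp add: Y_def tendsto_power2_0_iff LIM_zero_iff)
    have ratio: "(\<lambda>n. real (gap_count (dec (\<zeta> n)) g) / real (length (dec (\<zeta> n)) - 1)) \<longlonglongrightarrow> P g" for g
    proof (rule Lim_transform_eventually)
      \<comment> \<open>The normalization \<open>\<mu> n\<close> cancels, leaving the masses of the
        individual gap measure.\<close>
      show "(\<lambda>n. x g n (\<zeta> n) / \<kappa> n (\<zeta> n)) \<longlonglongrightarrow> P g"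
        using tendsto_divide [OF x_lim \<kappa>_lim] by simp
      show "\<forall>\<^sub>F n in sequentially. x g n (\<zeta> n) / \<kappa> n (\<zeta> n)
          = real (gap_count (dec (\<zeta> n)) g) / real (length (dec (\<zeta> n)) - 1)"
        using eventually_gt_at_top [of 0]
      proof eventually_elim
        case (elim n)
        then show ?case
          using \<mu>_ge_1 [OF elim] by (simp add: x_def \<kappa>_def)
      qed
    qed
    show ?thesis
      unfolding weak_conv_m_def weak_conv_def
    proof (intro allI impI)
      fix t assume "isCont (cdf \<nu>) t"
      then show "(\<lambda>n. cdf (individual_gap_measure (dec (\<zeta> n))) t) \<longlonglongrightarrow> cdf \<nu> t"
        unfolding cdf_individual_gap_measure
        by (simp only: cdf_\<nu>) (intro tendsto_step_cdf ratio)
    qed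
  qed
  with A(1,2) show ?thesis by blast
qed

end
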